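(* Let $\mathcal K\subset\mathbb P^2_{\mathbb C}$ be a nonsingular conic and let $A,B,C,D,E,F$ be six distinct points of $\mathcal K$ in ricochet configuration ($R$-configuration), with this labelling; that is, there exist an isomorphism $\mathcal K\to\mathbb P^1_{\mathbb C}=\mathbb C\cup\{\infty\}$ and a complex number $t$ such that $A,B,C,D,E,F$ are sent respectively to $0,\ t,\ \infty,\ 1,\ \frac{t-1}{t+1},\ -1$. Then the two Pascal lines $$\left\{\begin{array}{ccc} A & B & C\\ F& E& D\end{array}\right\}\quad\text{and}\quad \left\{\begin{array}{ccc} A & E & C\\ D& B& F\end{array}\right\}$$ are equal.
   Context: For six distinct points $P_1,P_2,P_3,Q_1,Q_2,Q_3$ on a nonsingular conic $\mathcal K$ in the complex projective plane, Pascal's theorem says that the three points $P_1Q_2\cap P_2Q_1$, $P_2Q_3\cap P_3Q_2$, $P_1Q_3\cap P_3Q_1$ are collinear. The line containing them is called the Pascal (line) of the array and is denoted $\left\{\begin{array}{ccc} P_1 & P_2 & P_3\\ Q_1& Q_2& Q_3\end{array}\right\}$. Here $XY$ denotes the line joining $X$ and $Y$. The $R$-configuration has the following equivalent geometric description: $A,B,C,D$ are points on the conic; $V$ is the intersection of the tangents at $A$ and $C$; $F$ is the second intersection of $VD$ with $\mathcal K$; $W=AF\cap CD$; $Z$ is the second intersection of $VB$ with $\mathcal K$; and $E$ is the second intersection of $WZ$ with $\mathcal K$ (with $A,\dots,F$ distinct). *)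

theory Defs
  imports "HOL-Analysis.Analysis"
begin

text \<open>
  \<open>'n proj\<close> is the complex projective space of dimension \<open>CARD('n) - 1\<close>: nonzero vectors of
  \<open>complex ^ 'n\<close> modulo scaling.  So \<open>2 proj\<close> is the projective line, \<open>3 proj\<close> the projective plane.
\<close>

definition proportional :: "complex ^ 'n \<Rightarrow> complex ^ 'n \<Rightarrow> bool" where
  "proportional v w \<longleftrightarrow> v \<noteq> 0 \<and> w \<noteq> 0 \<and> (\<exists>c. c \<noteq> 0 \<and> w = c *s v)"

lemma part_equivp_proportional: "part_equivp (proportional :: complex ^ 'n \<Rightarrow> complex ^ 'n \<Rightarrow> bool)"
proof (rule part_equivpI)
  have "proportional (1 :: complex ^ 'n) 1"
    unfolding proportional_def by (auto intro!: exI[of _ 1])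
  then show "\<exists>v :: complex ^ 'n. proportional v v" ..
  show "symp (proportional :: complex ^ 'n \<Rightarrow> complex ^ 'n \<Rightarrow> bool)"
  proof (rule sympI)
    fix v w :: "complex ^ 'n"
    assume "proportional v w"
    then obtain c where "v \<noteq> 0" "w \<noteq> 0" "c \<noteq> 0" "w = c *s v"
      unfolding proportional_def by blast
    then show "proportional w v"
      unfolding proportional_def
      by (auto simp: vector_smult_assoc intro!: exI[of _ "inverse c"])
  qed
  show "transp (proportional :: complex ^ 'n \<Rightarrow> complex ^ 'n \<Rightarrow> bool)"
  proof (rule transpI)
    fix u v w :: "complex ^ 'n"
    assume "proportional u v" "proportional v w"
    then show "proportional u w"
      unfolding proportional_def
      by (metis vector_smult_assoc no_zero_divisors)
  qed
qed

text \<open>\<open>proj_pt v\<close> is the point with homogeneous coordinates \<open>v\<close>; it is meaningful only for \<open>v \<noteq> 0\<close>.\<close>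

quotient_type 'n proj = "complex ^ 'n::finite" / partial: proportional
  morphisms coords proj_pt
  by (rule part_equivp_proportional)

text \<open>Forms, i.e. homogeneous polynomials, of degree \<open>d\<close> as polynomial functions; \<open>\<alpha>\<close> ranges
  over the exponent vectors of total degree \<open>d\<close>.\<close>

definition form :: "nat \<Rightarrow> (complex ^ 'n \<Rightarrow> complex) \<Rightarrow> bool" where
  "form d f \<longleftrightarrow>
     (\<exists>c. \<forall>v. f v = (\<Sum>\<alpha> | (\<Sum>i\<in>UNIV. \<alpha> i) = d. c \<alpha> * (\<Prod>i\<in>UNIV. v $ i ^ \<alpha> i)))"

lemma finite_exponents: "finite {\<alpha> :: 'n::finite \<Rightarrow> nat. (\<Sum>i\<in>UNIV. \<alpha> i) = d}"
proof (rule finite_subset)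
  show "{\<alpha> :: 'n \<Rightarrow> nat. (\<Sum>i\<in>UNIV. \<alpha> i) = d} \<subseteq> UNIV \<rightarrow>\<^sub>E {..d}"
    by (auto simp: PiE_UNIV_domain intro: member_le_sum)
  show "finite (UNIV \<rightarrow>\<^sub>E {..d} :: ('n \<Rightarrow> nat) set)"
    by (rule finite_PiE) auto
qed

definition partial_deriv :: "'n \<Rightarrow> (complex ^ 'n \<Rightarrow> complex) \<Rightarrow> complex ^ 'n \<Rightarrow> complex" where
  "partial_deriv i f v = deriv (\<lambda>s. f (\<chi> j. if j = i then s else v $ j)) (v $ i)"

definition zero_locus :: "(complex ^ 'n \<Rightarrow> complex) \<Rightarrow> 'n proj set" where
  "zero_locus f = {proj_pt v | v. v \<noteq> 0 \<and> f v = 0}"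

definition nonsingular_conic :: "3 proj set \<Rightarrow> bool" where
  "nonsingular_conic K \<longleftrightarrow>
     (\<exists>f. form 2 f \<and> K = zero_locus f \<and>
          (\<forall>v. v \<noteq> 0 \<and> f v = 0 \<longrightarrow> (\<exists>i. partial_deriv i f v \<noteq> 0)))"

text \<open>
  A morphism is a map that is locally, in the Zariski topology, given by forms of the same degree
  without common zeros; the basic neighbourhoods of a point are the complements of \<open>h = 0\<close> for
  forms \<open>h\<close> that do not vanish there.
\<close>

definition proj_morphism :: "'m::finite proj set \<Rightarrow> 'n::finite proj set \<Rightarrow> ('m proj \<Rightarrow> 'n proj) \<Rightarrow> bool" where
  "proj_morphism X Y \<phi> \<longleftrightarrow>
     \<phi> ` X \<subseteq> Y \<and>
     (\<forall>v. v \<noteq> 0 \<and> proj_pt v \<in> X \<longrightarrow>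
        (\<exists>d F e h. (\<forall>i. form d (\<lambda>w. F w $ i)) \<and> form e h \<and> h v \<noteq> 0 \<and>
           (\<forall>w. w \<noteq> 0 \<and> proj_pt w \<in> X \<and> h w \<noteq> 0 \<longrightarrow>
                F w \<noteq> 0 \<and> \<phi> (proj_pt w) = proj_pt (F w))))"

definition proj_isomorphism :: "'m::finite proj set \<Rightarrow> 'n::finite proj set \<Rightarrow> ('m proj \<Rightarrow> 'n proj) \<Rightarrow> bool" where
  "proj_isomorphism X Y \<phi> \<longleftrightarrow>
     proj_morphism X Y \<phi> \<and>
     (\<exists>\<psi>. proj_morphism Y X \<psi> \<and> (\<forall>p\<in>X. \<psi> (\<phi> p) = p) \<and> (\<forall>q\<in>Y. \<phi> (\<psi> q) = q))"

definition finite_pt :: "complex \<Rightarrow> 2 proj" where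
  "finite_pt z = proj_pt (vector [z, 1])"

definition infinite_pt :: "2 proj" where
  "infinite_pt = proj_pt (vector [1, 0])"

text \<open>If \<open>t = -1\<close>, then \<open>B\<close> and \<open>F\<close> have the same image and hence coincide, so for distinct points
  the division below is never by zero.\<close>

definition ricochet_configuration ::
  "3 proj set \<Rightarrow> 3 proj \<Rightarrow> 3 proj \<Rightarrow> 3 proj \<Rightarrow> 3 proj \<Rightarrow> 3 proj \<Rightarrow> 3 proj \<Rightarrow> bool" where
  "ricochet_configuration K A B C D E F \<longleftrightarrow>
     (\<exists>\<phi> t. proj_isomorphism K (UNIV :: 2 proj set) \<phi> \<and>
        \<phi> A = finite_pt 0 \<and> \<phi> B = finite_pt t \<and> \<phi> C = infinite_pt \<and>
        \<phi> D = finite_pt 1 \<and> \<phi> E = finite_pt ((t - 1) / (t + 1)) \<and> \<phi> F = finite_pt (- 1))"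

definition is_line :: "3 proj set \<Rightarrow> bool" where
  "is_line L \<longleftrightarrow> (\<exists>a. a \<noteq> 0 \<and> L = zero_locus (\<lambda>v. \<Sum>i\<in>UNIV. a $ i * v $ i))"

text \<open>The definite descriptions below are proper when the two points, respectively the two lines,
  are distinct.\<close>

definition join :: "3 proj \<Rightarrow> 3 proj \<Rightarrow> 3 proj set" where
  "join X Y = (THE L. is_line L \<and> X \<in> L \<and> Y \<in> L)"

definition meet :: "3 proj set \<Rightarrow> 3 proj set \<Rightarrow> 3 proj" where
  "meet L M = (THE X. X \<in> L \<and> X \<in> M)"

text \<open>\<open>pascal_line P1 P2 P3 Q1 Q2 Q3\<close> is the Pascal of the array with rows \<open>P1 P2 P3\<close> and
  \<open>Q1 Q2 Q3\<close>.  For six distinct points on a nonsingular conic such a line exists by Pascal's theorem,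
  and it is unique because the three points on it are pairwise distinct.\<close>

definition pascal_line ::
  "3 proj \<Rightarrow> 3 proj \<Rightarrow> 3 proj \<Rightarrow> 3 proj \<Rightarrow> 3 proj \<Rightarrow> 3 proj \<Rightarrow> 3 proj set" where
  "pascal_line P1 P2 P3 Q1 Q2 Q3 =
     (THE L. is_line L \<and>
        meet (join P1 Q2) (join P2 Q1) \<in> L \<and>
        meet (join P2 Q3) (join P3 Q2) \<in> L \<and>
        meet (join P1 Q3) (join P3 Q1) \<in> L)"

end

theory Submission
  imports Defs "HOL-Computational_Algebra.Field_as_Ring"
    "HOL-Computational_Algebra.Polynomial_Factorial"
    "HOL-Computational_Algebra.Fundamental_Theorem_Algebra"
begin

text \<open>
  Choosing coordinates adapted to the points \<open>A\<close>, \<open>C\<close> and the pole of the line \<open>AC\<close>, the conic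
  becomes \<open>y\<^sup>2 = x z\<close>, parametrised by \<open>u \<mapsto> (1, u, u\<^sup>2)\<close> with \<open>A\<close> at \<open>0\<close> and \<open>C\<close> at \<open>\<infinity>\<close>.  The
  composition of the given isomorphism with this parametrisation is a Moebius map fixing \<open>0\<close> and
  \<open>\<infinity>\<close>, hence a scaling, which is absorbed into the coordinates.  Now the six points have the
  parameters \<open>0, t, \<infinity>, 1, (t - 1) / (t + 1), - 1\<close>, and each of the six intersection points has the
  form \<open>(1, y, - 1)\<close>; so both Pascal lines are \<open>x + z = 0\<close>.
\<close>

section \<open>Injective rational maps of the line\<close>

lemma proportional_refl: "v \<noteq> 0 \<Longrightarrow> proportional v v"
  unfolding proportional_def by (auto intro!: exI[of _ 1])

lemma proj_pt_eq_iff: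
  assumes "u \<noteq> 0" "v \<noteq> 0"
  shows "proj_pt u = proj_pt v \<longleftrightarrow> (\<exists>k. k \<noteq> 0 \<and> v = k *s u)"
  using Quotient_rel_abs2[OF Quotient_proj] Quotient_rel[OF Quotient_proj, of u v] proportional_refl assms
  unfolding proportional_def by blast

lemma proj_pt_scale: "k \<noteq> 0 \<Longrightarrow> v \<noteq> 0 \<Longrightarrow> proj_pt (k *s v) = proj_pt v"
  by (subst eq_commute, subst proj_pt_eq_iff) (auto simp: vec_eq_iff)

lemma proj_pt_exhaust:
  obtains v where "v \<noteq> 0" "X = proj_pt v"
  using Quotient_abs_rep[OF Quotient_proj, of X] Quotient_rep_reflp[OF Quotient_proj, of X]
  unfolding proportional_def by metis

lemma vector2_eq_0_iff: "vector [x, y] = (0 :: complex ^ 2) \<longleftrightarrow> x = 0 \<and> y = 0"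
  by (simp add: vec_eq_iff forall_2)

lemma proj_pt_vector2_eq_iff:
  fixes x y x' y' :: complex
  assumes "x \<noteq> 0 \<or> y \<noteq> 0" "x' \<noteq> 0 \<or> y' \<noteq> 0"
  shows "proj_pt (vector [x, y] :: complex ^ 2) = proj_pt (vector [x', y']) \<longleftrightarrow> x * y' = x' * y"
proof -
  have "(\<exists>k. k \<noteq> 0 \<and> x' = k * x \<and> y' = k * y) \<longleftrightarrow> x * y' = x' * y"
  proof
    assume eq: "x * y' = x' * y"
    show "\<exists>k. k \<noteq> 0 \<and> x' = k * x \<and> y' = k * y"
    proof (cases "x = 0")
      case True
      then show ?thesis using assms eq by (intro exI[of _ "y' / y"]) auto
    next
      case False
      then have "x' \<noteq> 0" using assms eq by auto
      then show ?thesis using False eq by (intro exI[of _ "x' / x"]) (auto simp: field_simps)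
    qed
  qed auto
  then show ?thesis
    using assms by (subst proj_pt_eq_iff) (auto simp: vector2_eq_0_iff vec_eq_iff forall_2)
qed

text \<open>Along a polynomially parametrised curve, the forms that locally describe a morphism
  become polynomials in one variable.\<close>

lemma form_along_polys:
  assumes "form d f"
  shows "\<exists>p. \<forall>z. f (\<chi> i. poly (q i) z) = poly p z"
proof -
  obtain c where "\<And>v. f v = (\<Sum>\<alpha> | (\<Sum>i\<in>UNIV. \<alpha> i) = d. c \<alpha> * (\<Prod>i\<in>UNIV. v $ i ^ \<alpha> i))"
    using assms unfolding form_def by blast
  then show ?thesis
    by (intro exI[of _ "\<Sum>\<alpha> | (\<Sum>i\<in>UNIV. \<alpha> i) = d. smult (c \<alpha>) (\<Prod>i\<in>UNIV. q i ^ \<alpha> i)"])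
      (simp add: poly_sum poly_prod)
qed

lemma degree_le_1_pCons:
  assumes "degree p \<le> 1"
  shows "\<exists>a b. p = [:a, b:]"
proof (cases p)
  case (pCons a q)
  then have "degree q = 0" using assms by (auto split: if_splits)
  then show ?thesis using pCons by (metis degree_eq_zeroE)
qed

lemma infinite_nonroots:
  fixes p :: "complex poly"
  assumes "p \<noteq> 0"
  shows "infinite {z. poly p z \<noteq> 0}"
proof -
  have "{z. poly p z \<noteq> 0} = UNIV - {z. poly p z = 0}" by auto
  then show ?thesis
    using poly_roots_finite[OF assms] infinite_UNIV_char_0[where 'a=complex] by (simp add: Diff_infinite_finite)
qed

text \<open>Splitting off a root \<open>a\<close> leaves a quotient \<open>q\<close> of positive
  degree, which again has a root. The derivative of \<open>p\<close> at \<open>a\<close> is the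
  value of \<open>q\<close> there, so simplicity of \<open>a\<close> keeps the root of
  \<open>q\<close> away from \<open>a\<close>.\<close>

lemma two_roots_if_no_double_root:
  fixes p :: "complex poly"
  assumes deg: "degree p \<ge> 2" and simple: "\<And>a. poly p a = 0 \<Longrightarrow> poly (pderiv p) a \<noteq> 0"
  obtains a b where "a \<noteq> b" "poly p a = 0" "poly p b = 0"
proof -
  have root: "\<exists>z. poly q z = 0" if "degree q \<ge> 1" for q :: "complex poly"
    using that fundamental_theorem_of_algebra constant_degree by (metis not_one_le_zero)
  obtain a where a: "poly p a = 0" using root deg by force
  then obtain q where q: "p = [:- a, 1:] * q" by (auto simp: poly_eq_0_iff_dvd)
  have "q \<noteq> 0" using q deg by auto
  then have "degree p = 1 + degree q" using q by (simp add: degree_mult_eq del: mult_pCons_left)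
  then obtain b where b: "poly q b = 0" using root[of q] deg by auto
  have "poly (pderiv p) a = poly q a"
    by (simp add: q pderiv_mult pderiv_pCons del: mult_pCons_left)
  then have "a \<noteq> b" using simple[OF a] b by auto
  then show ?thesis using that[of a b] a b q by simp
qed

text \<open>A fibre over a value which is neither critical nor attained at an excluded point consists of
  simple roots, as many as the degree of the map; injectivity therefore forces degree one.\<close>

lemma locally_rational_inj_imp_moebius:
  fixes \<Phi> :: "complex \<Rightarrow> 2 proj"
  assumes inj: "inj \<Phi>"
    and rational: "\<And>z0. \<exists>f g h. poly h z0 \<noteq> 0 \<and> (\<forall>z. poly h z \<noteq> 0 \<longrightarrow>
        (poly f z \<noteq> 0 \<or> poly g z \<noteq> 0) \<and> \<Phi> z = proj_pt (vector [poly f z, poly g z]))"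
  obtains \<alpha> \<beta> \<gamma> \<delta> where "\<alpha> * \<delta> \<noteq> \<beta> * \<gamma>"
    "\<And>z. \<Phi> z = proj_pt (vector [\<alpha> + \<beta> * z, \<gamma> + \<delta> * z])"
proof -
  obtain f0 g0 h where h0: "poly h 0 \<noteq> 0"
    and fg0: "\<And>z. poly h z \<noteq> 0 \<Longrightarrow> (poly f0 z \<noteq> 0 \<or> poly g0 z \<noteq> 0) \<and>
        \<Phi> z = proj_pt (vector [poly f0 z, poly g0 z])"
    using rational[of 0] by blast
  \<comment> \<open>Cancelling the gcd gives a pair without common roots that represents
    \<open>\<Phi>\<close> wherever \<open>h\<close> does not vanish.\<close>
  define d where "d = gcd f0 g0"
  have "f0 \<noteq> 0 \<or> g0 \<noteq> 0" using fg0[OF h0] by auto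
  then have dnz: "d \<noteq> 0" by (simp add: d_def)
  obtain f g where f: "f0 = f * d" and g: "g0 = g * d" and cop: "coprime f g"
    using dnz gcd_coprime_exists[of f0 g0] unfolding d_def by metis
  have no_common: "poly f a \<noteq> 0 \<or> poly g a \<noteq> 0" for a
  proof (rule ccontr)
    assume "\<not> ?thesis"
    then have "[:- a, 1:] dvd f" "[:- a, 1:] dvd g" by (auto simp: poly_eq_0_iff_dvd)
    then have "is_unit [:- a, 1:]" using cop not_coprimeI by blast
    then show False by (auto simp: is_unit_iff_degree)
  qed
  have fg: "\<Phi> z = proj_pt (vector [poly f z, poly g z])" if "poly h z \<noteq> 0" for z
    using fg0[OF that] no_common[of z] f g by (simp add: proj_pt_vector2_eq_iff)
  have hnz: "h \<noteq> 0" using h0 by auto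
  \<comment> \<open>The Wronskian, up to sign the numerator of the derivative of
    \<open>f / g\<close>. If it vanished, coprimality would give \<open>g dvd pderiv g\<close> and
    \<open>f dvd pderiv f\<close>, so both would be constant and \<open>\<Phi>\<close> would take
    one value on an infinite set.\<close>
  define W where "W = f * pderiv g - pderiv f * g"
  have W: "W \<noteq> 0"
  proof
    assume "W = 0"
    then have eq: "f * pderiv g = pderiv f * g" by (simp add: W_def)
    have "g dvd pderiv g" using eq cop
      by (metis coprime_commute coprime_dvd_mult_right_iff dvd_triv_right)
    then have dg: "degree g = 0"
      using dvd_imp_degree_le[of g "pderiv g"] degree_pderiv[of g] pderiv_eq_0_iff[of g] by fastforce
    have "f dvd pderiv f" using eq cop
      by (metis coprime_dvd_mult_left_iff dvd_triv_left)
    then have df: "degree f = 0"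
      using dvd_imp_degree_le[of f "pderiv f"] degree_pderiv[of f] pderiv_eq_0_iff[of f] by fastforce
    obtain x y where "f = [:x:]" "g = [:y:]" using df dg by (meson degree_eq_zeroE)
    then have "\<Phi> ` {z. poly h z \<noteq> 0} \<subseteq> {proj_pt (vector [x, y])}" using fg by auto
    then have "finite {z. poly h z \<noteq> 0}"
      using finite_imageD[of \<Phi>] inj by (meson finite.emptyI finite_insert finite_subset inj_on_subset subset_UNIV)
    then show False using infinite_nonroots[OF hnz] by simp
  qed
  define n where "n = max (degree f) (degree g)"
  have "n \<le> 1"
  proof (rule ccontr)
    assume "\<not> n \<le> 1"
    then have n: "n \<ge> 2" by simp
    \<comment> \<open>The values to avoid: the one at infinity, so that \<open>f - smult c g\<close>
      keeps degree \<open>n\<close>, and those at critical points or at roots of \<open>h\<close>.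
      Where a denominator is 0 the quotient is 0, which merely excludes the value 0 as well.\<close>
    have "finite ((\<lambda>a. poly f a / poly g a) ` {a. poly (W * h) a = 0} \<union> {coeff f n / coeff g n})"
      using W hnz by (intro finite_UnI finite_imageI poly_roots_finite) auto
    then obtain c where c: "c \<noteq> coeff f n / coeff g n"
      "\<And>a. poly (W * h) a = 0 \<Longrightarrow> c \<noteq> poly f a / poly g a"
      using ex_new_if_finite[OF infinite_UNIV_char_0[where 'a=complex]] by blast
    define p where "p = f - smult c g"
    have "coeff f n \<noteq> 0 \<or> coeff g n \<noteq> 0"
      using n leading_coeff_0_iff[of f] leading_coeff_0_iff[of g]
      by (cases "degree f \<le> degree g") (auto simp: n_def max_def)
    then have "coeff p n \<noteq> 0" using c(1) by (cases "coeff g n = 0") (simp_all add: p_def eq_divide_eq)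
    then have "degree p \<ge> 2" using n le_degree by (meson order_trans)
    have root: "poly f a = c * poly g a \<and> poly g a \<noteq> 0 \<and> poly W a \<noteq> 0 \<and> poly h a \<noteq> 0"
      if "poly p a = 0" for a
    proof -
      have 1: "poly f a = c * poly g a" using that by (simp add: p_def)
      then have 2: "poly g a \<noteq> 0" using no_common[of a] by auto
      then show ?thesis using 1 c(2)[of a] by auto
    qed
    \<comment> \<open>At a double root both \<open>f = c * g\<close> and the same relation between
      the derivatives hold, which makes the Wronskian vanish.\<close>
    have "poly (pderiv p) a \<noteq> 0" if "poly p a = 0" for a
    proof
      assume "poly (pderiv p) a = 0"
      then have "poly (pderiv f) a = c * poly (pderiv g) a"
        by (simp add: p_def pderiv_diff pderiv_smult)
      then have "poly W a = 0" using conjunct1[OF root[OF that]] by (simp add: W_def)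
      then show False using root[OF that] by blast
    qed
    then obtain a b where ab: "a \<noteq> b" "poly p a = 0" "poly p b = 0"
      using two_roots_if_no_double_root[OF \<open>degree p \<ge> 2\<close>] by blast
    have "\<Phi> a = \<Phi> b"
      using root[OF ab(2)] root[OF ab(3)] by (simp add: fg proj_pt_vector2_eq_iff)
    then show False using inj ab(1) by (simp add: inj_eq)
  qed
  then have "degree f \<le> 1" "degree g \<le> 1" by (auto simp: n_def)
  then obtain \<alpha> \<beta> \<gamma> \<delta> where fl: "f = [:\<alpha>, \<beta>:]" and gl: "g = [:\<gamma>, \<delta>:]"
    by (metis degree_le_1_pCons)
  show ?thesis
  proof
    show "\<alpha> * \<delta> \<noteq> \<beta> * \<gamma>"
      using W by (auto simp: W_def fl gl pderiv_pCons algebra_simps)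
    fix z
    obtain f1 g1 h1 where h1: "poly h1 z \<noteq> 0"
      and fg1: "\<And>z. poly h1 z \<noteq> 0 \<Longrightarrow> (poly f1 z \<noteq> 0 \<or> poly g1 z \<noteq> 0) \<and>
          \<Phi> z = proj_pt (vector [poly f1 z, poly g1 z])"
      using rational[of z] by blast
    \<comment> \<open>The linear formula is so far known only off the roots of \<open>h\<close>. It
      extends to any \<open>z\<close> by comparison with the representation near \<open>z\<close>:
      the cross-multiplied difference vanishes off the roots of \<open>h1 * h\<close>, hence
      identically.\<close>
    have "poly ((f1 * g - f * g1) * (h1 * h)) x = 0" for x
    proof (cases "poly h1 x = 0 \<or> poly h x = 0")
      case False
      then have "proj_pt (vector [poly f1 x, poly g1 x] :: complex ^ 2) = proj_pt (vector [poly f x, poly g x])"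
        using fg fg1 by metis
      then show ?thesis using False fg1[of x] no_common[of x] by (simp add: proj_pt_vector2_eq_iff)
    qed auto
    then have "(f1 * g - f * g1) * (h1 * h) = 0" using poly_all_0_iff_0 by blast
    then have "f1 * g = f * g1" using hnz h1 by auto
    then have "poly f1 z * poly g z = poly f z * poly g1 z" by (metis poly_mult)
    then have "\<Phi> z = proj_pt (vector [poly f z, poly g z])"
      using fg1[OF h1] no_common[of z] by (simp add: proj_pt_vector2_eq_iff)
    then show "\<Phi> z = proj_pt (vector [\<alpha> + \<beta> * z, \<gamma> + \<delta> * z])" by (simp add: fl gl mult.commute)
  qed
qed

section \<open>Lines and points in a coordinate frame\<close>

definition dot :: "complex ^ 3 \<Rightarrow> complex ^ 3 \<Rightarrow> complex" where
  "dot l v = (\<Sum>i\<in>UNIV. l $ i * v $ i)"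

definition cross :: "complex ^ 3 \<Rightarrow> complex ^ 3 \<Rightarrow> complex ^ 3" where
  "cross u v = vector [u $ 2 * v $ 3 - u $ 3 * v $ 2, u $ 3 * v $ 1 - u $ 1 * v $ 3,
     u $ 1 * v $ 2 - u $ 2 * v $ 1]"

definition line :: "complex ^ 3 \<Rightarrow> 3 proj set" where
  "line l = zero_locus (dot l)"

lemma dot_3: "dot l v = l $ 1 * v $ 1 + l $ 2 * v $ 2 + l $ 3 * v $ 3"
  by (simp add: dot_def sum_3)

lemma cross_nth [simp]:
  "cross u v $ 1 = u $ 2 * v $ 3 - u $ 3 * v $ 2"
  "cross u v $ 2 = u $ 3 * v $ 1 - u $ 1 * v $ 3"
  "cross u v $ 3 = u $ 1 * v $ 2 - u $ 2 * v $ 1"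
  by (simp_all add: cross_def)

lemma vector3_eq_0_iff: "vector [x, y, z] = (0 :: complex ^ 3) \<longleftrightarrow> x = 0 \<and> y = 0 \<and> z = 0"
  by (simp add: vec_eq_iff forall_3)

lemma cross_vector3: "cross (vector [x, y, z]) (vector [x', y', z']) =
    vector [y * z' - z * y', z * x' - x * z', x * y' - y * x']"
  by (simp add: vec_eq_iff forall_3)

lemma dot_commute: "dot u v = dot v u"
  by (simp add: dot_3 mult.commute)

lemma dot_0 [simp]: "dot 0 v = 0" "dot l 0 = 0"
  by (simp_all add: dot_3)

text \<open>The Binet-Cauchy identity.\<close>

lemma dot_cross_cross: "dot (cross k l) (cross u v) = dot k u * dot l v - dot k v * dot l u"
  by (simp add: dot_3 algebra_simps)

text \<open>By the triple product expansion, the cross product of \<open>cross u v\<close> and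
  \<open>l\<close> is a combination of \<open>u\<close> and \<open>v\<close> with coefficients
  \<open>dot v l\<close> and \<open>dot u l\<close> up to sign, so all minors of the pair vanish.
  This gives the uniqueness of joins and meets.\<close>

lemma orthogonal_imp_multiple_of_cross:
  assumes "dot u l = 0" "dot v l = 0" "cross u v \<noteq> 0"
  obtains k where "l = k *s cross u v"
proof -
  obtain i where i: "cross u v $ i \<noteq> 0" using assms(3) by (auto simp: vec_eq_iff)
  have "cross u v $ i * l $ j = l $ i * cross u v $ j" for j
  proof -
    have "\<forall>i j. cross u v $ i * l $ j = l $ i * cross u v $ j"
      using assms(1,2) unfolding forall_3 dot_3 cross_nth by algebra
    then show ?thesis by blast
  qed
  then have "l = (l $ i / cross u v $ i) *s cross u v"
    using i by (simp add: vec_eq_iff field_simps)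
  then show ?thesis using that by blast
qed

lemma cross_eq_0_imp_proportional:
  assumes "u \<noteq> 0" "v \<noteq> 0" "cross u v = 0"
  obtains k where "k \<noteq> 0" "v = k *s u"
proof -
  obtain i where i: "u $ i \<noteq> 0" using assms(1) by (auto simp: vec_eq_iff)
  have "\<forall>i j. u $ i * v $ j = v $ i * u $ j"
    using assms(3) unfolding vec_eq_iff forall_3 cross_nth zero_index by (simp add: algebra_simps)
  then have eq: "v = (v $ i / u $ i) *s u" using i by (simp add: vec_eq_iff field_simps)
  then have "v $ i / u $ i \<noteq> 0" using assms(2) by (metis vector_smult_lzero)
  then show ?thesis using that eq by blast
qed

lemma proj_pt_in_zero_locus_iff:
  assumes "v \<noteq> 0" and homogeneous: "\<And>k w. f (k *s w) = k ^ d * f w"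
  shows "proj_pt v \<in> zero_locus f \<longleftrightarrow> f v = 0"
proof
  assume "proj_pt v \<in> zero_locus f"
  then obtain w where "w \<noteq> 0" "f w = 0" "proj_pt w = proj_pt v" unfolding zero_locus_def by auto
  then obtain k where "v = k *s w" using proj_pt_eq_iff[of w v] assms(1) by auto
  then show "f v = 0" using homogeneous \<open>f w = 0\<close> by simp
qed (use assms(1) in \<open>auto simp: zero_locus_def\<close>)

lemma proj_pt_in_line_iff: "v \<noteq> 0 \<Longrightarrow> proj_pt v \<in> line l \<longleftrightarrow> dot l v = 0"
  unfolding line_def by (rule proj_pt_in_zero_locus_iff[of _ _ 1]) (auto simp: dot_3 algebra_simps)

lemma is_line_iff: "is_line L \<longleftrightarrow> (\<exists>l. l \<noteq> 0 \<and> L = line l)"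
  by (simp add: is_line_def line_def dot_def[abs_def])

lemma line_smult: "k \<noteq> 0 \<Longrightarrow> line (k *s l) = line l"
  by (auto simp: line_def zero_locus_def dot_3 mult.assoc simp flip: distrib_left)

text \<open>Evaluates the definite description by exhibiting a line: the coefficients of any line
  through both points are orthogonal to \<open>u\<close> and \<open>v\<close>, hence a multiple of
  \<open>cross u v\<close>. The lemma on \<open>meet\<close> is the dual.\<close>

lemma join_eqI:
  assumes "cross u v \<noteq> 0" "is_line L" "proj_pt u \<in> L" "proj_pt v \<in> L"
  shows "join (proj_pt u) (proj_pt v) = L"
proof -
  have nz: "u \<noteq> 0" "v \<noteq> 0" using assms(1) by (auto simp: vec_eq_iff forall_3)
  have "M = line (cross u v)" if "is_line M" "proj_pt u \<in> M" "proj_pt v \<in> M" for M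
  proof -
    obtain l where l: "l \<noteq> 0" "M = line l" using \<open>is_line M\<close> by (auto simp: is_line_iff)
    then have "dot u l = 0" "dot v l = 0"
      using that nz by (auto simp: proj_pt_in_line_iff dot_commute)
    then obtain k where "l = k *s cross u v"
      using orthogonal_imp_multiple_of_cross assms(1) by blast
    moreover from this have "k \<noteq> 0" using l by (auto simp: vec_eq_iff)
    ultimately show ?thesis using l line_smult by simp
  qed
  then show ?thesis unfolding join_def using assms by (intro the_equality) blast+
qed

lemma meet_eqI:
  assumes "cross l m \<noteq> 0" "X \<in> line l" "X \<in> line m"
  shows "meet (line l) (line m) = X"
proof -
  have "Y = proj_pt (cross l m)" if "Y \<in> line l" "Y \<in> line m" for Y
  proof -
    obtain y where y: "y \<noteq> 0" "Y = proj_pt y" by (rule proj_pt_exhaust)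
    then have "dot l y = 0" "dot m y = 0" using that by (auto simp: proj_pt_in_line_iff)
    then obtain k where "y = k *s cross l m"
      using orthogonal_imp_multiple_of_cross assms by blast
    moreover from this have "k \<noteq> 0" using y by (auto simp: vec_eq_iff)
    ultimately show ?thesis using y assms proj_pt_scale by simp
  qed
  then show ?thesis unfolding meet_def using assms by (intro the_equality) blast+
qed

text \<open>The vectors form a basis; the number in \<open>det\<close> is minus the determinant of
  \<open>a\<close>, \<open>v\<close>, \<open>c\<close> in this order, whence the signs in the
  identities below.\<close>

locale frame =
  fixes a v c :: "complex ^ 3"
  assumes det: "dot v (cross a c) \<noteq> 0"
begin

definition comb :: "complex ^ 3 \<Rightarrow> complex ^ 3" where
  "comb x = x $ 1 *s a + x $ 2 *s v + x $ 3 *s c"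

text \<open>The cofactor matrix of \<open>comb\<close>. It carries coefficients of a linear form in
  frame coordinates to standard ones, up to the determinant, so no inverse matrix is needed.\<close>

definition cocomb :: "complex ^ 3 \<Rightarrow> complex ^ 3" where
  "cocomb l = l $ 1 *s cross v c + l $ 2 *s cross c a + l $ 3 *s cross a v"

lemma cross_comb: "cross (comb x) (comb y) = cocomb (cross x y)"
  by (simp add: vec_eq_iff forall_3 comb_def cocomb_def algebra_simps)

lemma cross_cocomb: "cross (cocomb l) (cocomb m) = - dot v (cross a c) *s comb (cross l m)"
  by (simp add: vec_eq_iff forall_3 comb_def cocomb_def dot_3 algebra_simps)

lemma dot_cocomb_comb: "dot (cocomb l) (comb x) = - dot v (cross a c) * dot l x"
  by (simp add: comb_def cocomb_def dot_3 algebra_simps)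

lemma dot_eq_0_imp:
  assumes "dot l a = 0" "dot l v = 0" "dot l c = 0"
  shows "l = 0"
proof -
  have "\<forall>i. dot v (cross a c) * l $ i = 0"
    using assms unfolding forall_3 dot_3 cross_nth by algebra
  then show ?thesis using det by (simp add: vec_eq_iff)
qed

lemma comb_eq_0_iff [simp]: "comb x = 0 \<longleftrightarrow> x = 0"
proof
  assume "comb x = 0"
  then have "dot l x = 0" for l
    using dot_cocomb_comb[of l x] det by simp
  from this[of "vector [1, 0, 0]"] this[of "vector [0, 1, 0]"] this[of "vector [0, 0, 1]"]
  show "x = 0" by (simp add: dot_3 vec_eq_iff forall_3)
qed (simp add: comb_def)

lemma cocomb_eq_0_iff [simp]: "cocomb l = 0 \<longleftrightarrow> l = 0"
proof
  assume "cocomb l = 0"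
  then have "dot l x = 0" for x
    using dot_cocomb_comb[of l x] det by simp
  from this[of "vector [1, 0, 0]"] this[of "vector [0, 1, 0]"] this[of "vector [0, 0, 1]"]
  show "l = 0" by (simp add: dot_3 vec_eq_iff forall_3)
qed (simp add: cocomb_def)

definition pt :: "complex \<Rightarrow> complex \<Rightarrow> complex \<Rightarrow> 3 proj" where
  "pt x y z = proj_pt (comb (vector [x, y, z]))"

definition dual_line :: "complex \<Rightarrow> complex \<Rightarrow> complex \<Rightarrow> 3 proj set" where
  "dual_line x y z = line (cocomb (vector [x, y, z]))"

lemma pt_in_dual_line_iff: "x \<noteq> 0 \<or> y \<noteq> 0 \<or> z \<noteq> 0 \<Longrightarrow> pt x y z \<in> dual_line p q r \<longleftrightarrow> p * x + q * y + r * z = 0"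
  using det by (simp add: pt_def dual_line_def proj_pt_in_line_iff vector3_eq_0_iff dot_cocomb_comb) (simp add: dot_3)

lemma is_line_dual_line: "p \<noteq> 0 \<or> q \<noteq> 0 \<or> r \<noteq> 0 \<Longrightarrow> is_line (dual_line p q r)"
  unfolding dual_line_def is_line_iff by (auto simp: vector3_eq_0_iff intro!: exI[of _ "cocomb (vector [p, q, r])"])

lemma join_ptI:
  assumes "y * z' - z * y' \<noteq> 0 \<or> z * x' - x * z' \<noteq> 0 \<or> x * y' - y * x' \<noteq> 0"
    and "is_line L" "pt x y z \<in> L" "pt x' y' z' \<in> L"
  shows "join (pt x y z) (pt x' y' z') = L"
  using assms unfolding pt_def
  by (intro join_eqI) (simp_all add: cross_comb cross_vector3 vector3_eq_0_iff)

lemma meet_dual_lineI: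
  assumes "q * r' - r * q' \<noteq> 0 \<or> r * p' - p * r' \<noteq> 0 \<or> p * q' - q * p' \<noteq> 0"
    and "X \<in> dual_line p q r" "X \<in> dual_line p' q' r'"
  shows "meet (dual_line p q r) (dual_line p' q' r') = X"
  using assms det unfolding dual_line_def
  by (intro meet_eqI) (auto simp: cross_cocomb cross_vector3 vector3_eq_0_iff vector_mul_eq_0)

lemma pt_eq_imp:
  assumes "pt x y z = pt x' y' z'" "x \<noteq> 0 \<or> y \<noteq> 0 \<or> z \<noteq> 0" "x' \<noteq> 0 \<or> y' \<noteq> 0 \<or> z' \<noteq> 0"
  shows "y * z' = z * y' \<and> z * x' = x * z' \<and> x * y' = y * x'"
proof -
  obtain k where "comb (vector [x', y', z']) = k *s comb (vector [x, y, z])"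
    using assms proj_pt_eq_iff[of "comb (vector [x, y, z])" "comb (vector [x', y', z'])"]
    by (auto simp: pt_def vector3_eq_0_iff)
  then have "cross (comb (vector [x, y, z])) (comb (vector [x', y', z'])) = 0"
    by (simp add: vec_eq_iff forall_3)
  then show ?thesis by (simp add: cross_comb cross_vector3 vector3_eq_0_iff)
qed

lemma pt_scale: "k \<noteq> 0 \<Longrightarrow> x \<noteq> 0 \<or> y \<noteq> 0 \<or> z \<noteq> 0 \<Longrightarrow> pt (k * x) (k * y) (k * z) = pt x y z"
proof -
  assume "k \<noteq> 0" "x \<noteq> 0 \<or> y \<noteq> 0 \<or> z \<noteq> 0"
  moreover have "comb (vector [k * x, k * y, k * z]) = k *s comb (vector [x, y, z])"
    by (simp add: comb_def vec_eq_iff algebra_simps)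
  ultimately show ?thesis by (simp add: pt_def proj_pt_scale vector3_eq_0_iff)
qed

end

section \<open>The conic in a frame\<close>

text \<open>Every exponent vector of degree 2 gives a product of two coordinates. Induction over
  finite sets of exponents therefore collects the terms in a 3 by 3 matrix, each new exponent
  altering a single entry, and the explicit formula follows by adding opposite entries.\<close>

lemma form_2_imp_quadratic:
  fixes f :: "complex ^ 3 \<Rightarrow> complex"
  assumes "form 2 f"
  obtains b1 b2 b3 b4 b5 b6 where "\<And>v. f v = b1 * v$1 ^ 2 + b2 * v$2 ^ 2 + b3 * v$3 ^ 2
      + b4 * (v$2 * v$3) + b5 * (v$1 * v$3) + b6 * (v$1 * v$2)"
proof -
  obtain c where f: "\<And>v. f v = (\<Sum>\<alpha> | (\<Sum>i\<in>UNIV. \<alpha> i) = 2. c \<alpha> * (\<Prod>i\<in>UNIV. v $ i ^ \<alpha> i))"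
    using assms unfolding form_def by blast
  have monomial: "\<exists>i j. \<forall>v :: complex ^ 3. (\<Prod>k\<in>UNIV. v $ k ^ \<alpha> k) = v $ i * v $ j"
    if "(\<Sum>i\<in>UNIV. \<alpha> i) = 2" for \<alpha> :: "3 \<Rightarrow> nat"
  proof -
    have prod: "(\<Prod>k\<in>UNIV. v $ k ^ \<alpha> k) = v $ 1 ^ \<alpha> 1 * (v $ 2 ^ \<alpha> 2 * v $ 3 ^ \<alpha> 3)" for v :: "complex ^ 3"
      unfolding UNIV_3 by simp
    have "\<alpha> 1 + \<alpha> 2 + \<alpha> 3 = 2" using that by (simp add: sum_3)
    then have "\<alpha> 1 = 2 \<and> \<alpha> 2 = 0 \<and> \<alpha> 3 = 0 \<or> \<alpha> 1 = 0 \<and> \<alpha> 2 = 2 \<and> \<alpha> 3 = 0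
      \<or> \<alpha> 1 = 0 \<and> \<alpha> 2 = 0 \<and> \<alpha> 3 = 2 \<or> \<alpha> 1 = 0 \<and> \<alpha> 2 = 1 \<and> \<alpha> 3 = 1
      \<or> \<alpha> 1 = 1 \<and> \<alpha> 2 = 0 \<and> \<alpha> 3 = 1 \<or> \<alpha> 1 = 1 \<and> \<alpha> 2 = 1 \<and> \<alpha> 3 = 0"
      by presburger
    then show ?thesis
      unfolding prod by (elim disjE) (simp add: power2_eq_square, blast)+
  qed
  have "\<exists>b. \<forall>v :: complex ^ 3. (\<Sum>\<alpha>\<in>S. c \<alpha> * (\<Prod>i\<in>UNIV. v $ i ^ \<alpha> i))
      = (\<Sum>i\<in>UNIV. \<Sum>j\<in>UNIV. b i j * (v $ i * v $ j))"
    if "finite S" "S \<subseteq> {\<alpha>. (\<Sum>i\<in>UNIV. \<alpha> i) = 2}" for S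
    using that
  proof (induction S rule: finite_induct)
    case empty
    show ?case by (intro exI[of _ "\<lambda>i j. 0"]) simp
  next
    case (insert \<alpha> S)
    then obtain b where b: "\<And>v :: complex ^ 3. (\<Sum>\<alpha>\<in>S. c \<alpha> * (\<Prod>i\<in>UNIV. v $ i ^ \<alpha> i))
      = (\<Sum>i\<in>UNIV. \<Sum>j\<in>UNIV. b i j * (v $ i * v $ j))" by auto
    obtain k l where kl: "\<And>v :: complex ^ 3. (\<Prod>i\<in>UNIV. v $ i ^ \<alpha> i) = v $ k * v $ l"
      using monomial[of \<alpha>] insert.prems by auto
    have "(\<Sum>\<alpha>\<in>insert \<alpha> S. c \<alpha> * (\<Prod>i\<in>UNIV. v $ i ^ \<alpha> i))
      = (\<Sum>i\<in>UNIV. \<Sum>j\<in>UNIV. (b i j + (if i = k then if j = l then c \<alpha> else 0 else 0)) * (v $ i * v $ j))"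
      for v :: "complex ^ 3"
    proof -
      have "(\<Sum>i\<in>UNIV. \<Sum>j\<in>UNIV. (if i = k then if j = l then c \<alpha> else 0 else 0) * (v $ i * v $ j))
        = (\<Sum>i\<in>UNIV. if i = k then \<Sum>j\<in>UNIV. if j = l then c \<alpha> * (v $ i * v $ j) else 0 else 0)"
        by (intro sum.cong refl) (simp add: mult_delta_left)
      also have "\<dots> = c \<alpha> * (v $ k * v $ l)"
        by (simp only: sum.delta finite UNIV_I if_True)
      finally show ?thesis using insert.hyps by (simp add: b kl distrib_right sum.distrib)
    qed
    then show ?case
      by (intro exI[of _ "\<lambda>i j. b i j + (if i = k then if j = l then c \<alpha> else 0 else 0)"] allI)
  qed
  from this[OF finite_exponents order_refl]
  have "\<exists>b. \<forall>v. f v = (\<Sum>i\<in>UNIV. \<Sum>j\<in>UNIV. b i j * (v $ i * v $ j))" unfolding f .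
  then obtain b where "\<And>v. f v = (\<Sum>i\<in>UNIV. \<Sum>j\<in>UNIV. b i j * (v $ i * v $ j))" by auto
  then have "f v = b 1 1 * v$1 ^ 2 + b 2 2 * v$2 ^ 2 + b 3 3 * v$3 ^ 2 + (b 2 3 + b 3 2) * (v$2 * v$3)
      + (b 1 3 + b 3 1) * (v$1 * v$3) + (b 1 2 + b 2 1) * (v$1 * v$2)" for v
    by (simp add: sum_3 power2_eq_square algebra_simps)
  then show ?thesis by (rule that)
qed

text \<open>The frame consists of the two given points and the pole of the line joining them; the third
  vector is rescaled so that no square root is needed.\<close>

lemma nonsingular_conic_normal_form:
  assumes K: "nonsingular_conic K" and "A \<in> K" "C \<in> K" "A \<noteq> C"
  obtains a v c where "frame a v c" "A = frame.pt a v c 1 0 0" "C = frame.pt a v c 0 0 1"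
    "\<And>x y z. x \<noteq> 0 \<or> y \<noteq> 0 \<or> z \<noteq> 0 \<Longrightarrow> frame.pt a v c x y z \<in> K \<longleftrightarrow> y ^ 2 = x * z"
proof -
  obtain f where form: "form 2 f" and Kf: "K = zero_locus f"
    and smooth: "\<And>v. v \<noteq> 0 \<Longrightarrow> f v = 0 \<Longrightarrow> \<exists>i. partial_deriv i f v \<noteq> 0"
    using K unfolding nonsingular_conic_def by blast
  obtain b1 b2 b3 b4 b5 b6 where f: "\<And>v. f v = b1 * v$1 ^ 2 + b2 * v$2 ^ 2 + b3 * v$3 ^ 2
      + b4 * (v$2 * v$3) + b5 * (v$1 * v$3) + b6 * (v$1 * v$2)"
    using form_2_imp_quadratic[OF form] by blast
  \<comment> \<open>The gradient of \<open>f\<close>, a linear map; \<open>dot (G v) w\<close> is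
    the symmetric polar form, and \<open>G_self\<close> is Euler's identity.\<close>
  define G :: "complex ^ 3 \<Rightarrow> complex ^ 3" where
    "G v = vector [2 * b1 * v$1 + b6 * v$2 + b5 * v$3, b6 * v$1 + 2 * b2 * v$2 + b4 * v$3,
       b5 * v$1 + b4 * v$2 + 2 * b3 * v$3]" for v
  have "\<forall>i. partial_deriv i f v = G v $ i" for v
    unfolding forall_3 partial_deriv_def f G_def
    by (intro conjI DERIV_imp_deriv) (auto intro!: derivative_eq_intros simp: algebra_simps)
  then have G_nz: "G v \<noteq> 0" if "v \<noteq> 0" "f v = 0" for v using smooth[OF that] by auto
  have G_sym: "dot (G v) w = dot (G w) v" for v w
    by (simp add: G_def dot_3 algebra_simps)
  have G_self: "dot (G v) v = 2 * f v" for v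
    by (simp add: G_def f dot_3 power2_eq_square algebra_simps)
  have G_lin: "G (k *s v + l *s w) = k *s G v + l *s G w" for k l v w
    by (simp add: G_def vec_eq_iff forall_3 algebra_simps)
  have f_comb: "f (x *s u + y *s v + z *s w) = x ^ 2 * f u + y ^ 2 * f v + z ^ 2 * f w
      + x * y * dot (G u) v + x * z * dot (G u) w + y * z * dot (G w) v" for x y z u v w
    by (simp add: f G_def dot_3 power2_eq_square algebra_simps)
  have mem: "proj_pt v \<in> K \<longleftrightarrow> f v = 0" if "v \<noteq> 0" for v
    unfolding Kf by (rule proj_pt_in_zero_locus_iff[of _ _ 2])
      (use that in \<open>auto simp: f power2_eq_square algebra_simps\<close>)
  obtain a where a: "a \<noteq> 0" "A = proj_pt a" by (rule proj_pt_exhaust)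
  obtain c where c: "c \<noteq> 0" "C = proj_pt c" by (rule proj_pt_exhaust)
  have fa: "f a = 0" and fc: "f c = 0" using a c mem assms by auto
  have ac: "cross a c \<noteq> 0"
  proof
    assume "cross a c = 0"
    then obtain k where "k \<noteq> 0" "c = k *s a" by (rule cross_eq_0_imp_proportional[OF a(1) c(1)])
    then show False using a c proj_pt_scale[of k a] \<open>A \<noteq> C\<close> by simp
  qed
  define m where "m = dot (G a) c"
  have m': "m = dot (G c) a" by (simp add: m_def G_sym)
  \<comment> \<open>Otherwise the gradients at \<open>a\<close> and \<open>c\<close> are both
    multiples of \<open>cross a c\<close>, so some combination \<open>s\<close> of \<open>a\<close>
    and \<open>c\<close> has zero gradient. By Euler's identity \<open>f s = 0\<close>, and
    nonsingularity forces \<open>s = 0\<close>, against the independence of \<open>a\<close> and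
    \<open>c\<close>.\<close>
  have m: "m \<noteq> 0"
  proof
    assume "m = 0"
    then have "dot a (G a) = 0" "dot c (G a) = 0" "dot a (G c) = 0" "dot c (G c) = 0"
      using G_self fa fc m_def m' by (simp_all add: dot_commute)
    then obtain k l where k: "G a = k *s cross a c" and l: "G c = l *s cross a c"
      using orthogonal_imp_multiple_of_cross[OF _ _ ac] by metis
    have kl: "k \<noteq> 0" "l \<noteq> 0" using G_nz a c fa fc k l by (metis vector_smult_lzero)+
    define s where "s = l *s a + (- k) *s c"
    have "G s = l *s G a + (- k) *s G c" unfolding s_def by (rule G_lin)
    then have "G s = 0" by (simp add: k l vec_eq_iff)
    then have "s = 0" using G_nz[of s] G_self[of s] by auto
    then have "c = (l / k) *s a" using kl by (simp add: s_def vec_eq_iff field_simps)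
    then have "cross a c = 0" by (simp add: vec_eq_iff forall_3)
    then show False using ac by simp
  qed
  \<comment> \<open>The tangents at A and C have coefficient vectors \<open>G a\<close> and
    \<open>G c\<close>; their intersection \<open>w\<close> is the pole of the line AC.\<close>
  define w where "w = cross (G a) (G c)"
  have w_a: "dot (G a) w = 0" and w_c: "dot (G c) w = 0"
    by (simp_all add: w_def dot_3 algebra_simps)
  have "dot w (cross a c) = - m * m"
    using G_self[of a] G_self[of c] fa fc by (simp add: w_def dot_cross_cross flip: m_def m')
  then have "dot w (cross a c) \<noteq> 0" using m by simp
  then interpret F0: frame a w c by unfold_locales
  \<comment> \<open>If \<open>w\<close> lay on the conic, its gradient would be orthogonal to all
    three frame vectors, making \<open>w\<close> a singular point.\<close>
  have fw: "f w \<noteq> 0"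
  proof
    assume "f w = 0"
    then have "G w = 0" using w_a w_c G_self[of w] by (intro F0.dot_eq_0_imp) (simp_all add: G_sym[of w a] G_sym[of w c])
    moreover have "w \<noteq> 0" using F0.det by auto
    ultimately show False using G_nz \<open>f w = 0\<close> by blast
  qed
  \<comment> \<open>In the frame \<open>a\<close>, \<open>w\<close>, \<open>c\<close> the form is
    \<open>y^2 * f w + x * z * m\<close>. Rescaling \<open>c\<close> by this factor turns the
    coefficient of \<open>x * z\<close> into \<open>- f w\<close>.\<close>
  define k where "k = - f w / m"
  have k: "k \<noteq> 0" using fw m by (simp add: k_def)
  interpret F: frame a w "k *s c"
  proof
    have "dot w (cross a (k *s c)) = k * dot w (cross a c)" by (simp add: dot_3 algebra_simps)
    then show "dot w (cross a (k *s c)) \<noteq> 0" using F0.det k by simp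
  qed
  show ?thesis
  proof
    show "frame a w (k *s c)" ..
    show "A = F.pt 1 0 0" by (simp add: F.pt_def F.comb_def a)
    show "C = F.pt 0 0 1" using k c by (simp add: F.pt_def F.comb_def proj_pt_scale)
    fix x y z :: complex assume nz: "x \<noteq> 0 \<or> y \<noteq> 0 \<or> z \<noteq> 0"
    have "f (F.comb (vector [x, y, z])) = f (x *s a + y *s w + (z * k) *s c)"
      by (simp add: F.comb_def vector_smult_assoc)
    also have "\<dots> = y ^ 2 * f w + x * (z * k) * m"
      unfolding f_comb by (simp add: fa fc w_a w_c flip: m_def)
    also have "\<dots> = f w * (y ^ 2 - x * z)" using m by (simp add: k_def field_simps)
    finally show "F.pt x y z \<in> K \<longleftrightarrow> y ^ 2 = x * z"
      using nz fw by (simp add: F.pt_def mem vector3_eq_0_iff)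
  qed
qed

section \<open>The isomorphism in terms of the conic parameter\<close>

text \<open>The chart has polynomial coordinates, so composing it with the local forms of the
  morphism yields local rational representations, and the result on injective maps of the line
  applies.\<close>

lemma (in frame) morphism_on_conic_chart_moebius:
  assumes mor: "proj_morphism K (UNIV :: 2 proj set) \<phi>" and inj: "inj_on \<phi> K"
    and K: "\<And>z. pt 1 z (z ^ 2) \<in> K"
  obtains \<alpha> \<beta> \<gamma> \<delta> where "\<alpha> * \<delta> \<noteq> \<beta> * \<gamma>"
    "\<And>z. \<phi> (pt 1 z (z ^ 2)) = proj_pt (vector [\<alpha> + \<beta> * z, \<gamma> + \<delta> * z])"
proof -
  define q where "q i = [:a $ i, v $ i, c $ i:]" for i
  define P :: "complex \<Rightarrow> complex ^ 3" where "P z = (\<chi> i. poly (q i) z)" for z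
  have P: "pt 1 z (z ^ 2) = proj_pt (P z)" "P z \<noteq> 0" for z
  proof -
    have "P z = comb (vector [1, z, z ^ 2])"
      by (simp add: P_def q_def comb_def vec_eq_iff power2_eq_square algebra_simps)
    then show "pt 1 z (z ^ 2) = proj_pt (P z)" "P z \<noteq> 0" by (simp_all add: pt_def vector3_eq_0_iff)
  qed
  have inj_chart: "inj (\<lambda>z. \<phi> (pt 1 z (z ^ 2)))"
  proof (rule injI)
    fix x y assume "\<phi> (pt 1 x (x ^ 2)) = \<phi> (pt 1 y (y ^ 2))"
    then have "pt 1 x (x ^ 2) = pt 1 y (y ^ 2)" using inj K by (simp add: inj_on_eq_iff)
    then have "1 * y = x * 1" using pt_eq_imp by (metis zero_neq_one)
    then show "x = y" by simp
  qed
  have "\<exists>f g h. poly h z0 \<noteq> 0 \<and> (\<forall>z. poly h z \<noteq> 0 \<longrightarrow>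
        (poly f z \<noteq> 0 \<or> poly g z \<noteq> 0) \<and> \<phi> (pt 1 z (z ^ 2)) = proj_pt (vector [poly f z, poly g z]))" for z0
  proof -
    have "P z0 \<noteq> 0 \<and> proj_pt (P z0) \<in> K" using P K[of z0] by simp
    then obtain d F e h where F: "\<And>i. form d (\<lambda>w. F w $ i)" and h: "form e h" "h (P z0) \<noteq> 0"
      and \<phi>: "\<And>w. w \<noteq> 0 \<and> proj_pt w \<in> K \<and> h w \<noteq> 0 \<Longrightarrow> F w \<noteq> 0 \<and> \<phi> (proj_pt w) = proj_pt (F w)"
      using mor unfolding proj_morphism_def by blast
    obtain hp where hp: "\<And>z. h (P z) = poly hp z"
      using form_along_polys[OF h(1), of q] unfolding P_def by blast
    obtain f where f: "\<And>z. F (P z) $ 1 = poly f z"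
      using form_along_polys[OF F[of 1], of q] unfolding P_def by blast
    obtain g where g: "\<And>z. F (P z) $ 2 = poly g z"
      using form_along_polys[OF F[of 2], of q] unfolding P_def by blast
    have FP: "F (P z) = vector [poly f z, poly g z]" for z
      by (simp add: vec_eq_iff forall_2 f g)
    have "(poly f z \<noteq> 0 \<or> poly g z \<noteq> 0) \<and> \<phi> (pt 1 z (z ^ 2)) = proj_pt (vector [poly f z, poly g z])"
      if "poly hp z \<noteq> 0" for z
    proof -
      have "P z \<noteq> 0 \<and> proj_pt (P z) \<in> K \<and> h (P z) \<noteq> 0" using P K[of z] hp that by simp
      from \<phi>[OF this] show ?thesis unfolding FP P(1) vector2_eq_0_iff by blast
    qed
    moreover have "poly hp z0 \<noteq> 0" using h hp by simp
    ultimately have "poly hp z0 \<noteq> 0 \<and> (\<forall>z. poly hp z \<noteq> 0 \<longrightarrow> (poly f z \<noteq> 0 \<or> poly g z \<noteq> 0) \<and>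
        \<phi> (pt 1 z (z ^ 2)) = proj_pt (vector [poly f z, poly g z]))" by simp
    then show ?thesis by (intro exI)
  qed
  then show ?thesis
    by (rule locally_rational_inj_imp_moebius[OF inj_chart]) (rule that)
qed

text \<open>The isomorphism is a Moebius map both in the chart around \<open>A\<close> and in the
  one around \<open>C\<close>. The images of \<open>A\<close> and \<open>C\<close>, together with
  agreement on the overlap, reduce it to a scaling, which a rescaled frame absorbs.\<close>

lemma conic_isomorphism_coordinates:
  assumes K: "nonsingular_conic K" and iso: "proj_isomorphism K (UNIV :: 2 proj set) \<phi>"
    and AC: "A \<in> K" "C \<in> K" "\<phi> A = finite_pt 0" "\<phi> C = infinite_pt"
  obtains a v c where "frame a v c" "A = frame.pt a v c 1 0 0" "C = frame.pt a v c 0 0 1"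
    "\<And>X u. X \<in> K \<Longrightarrow> \<phi> X = finite_pt u \<Longrightarrow> X = frame.pt a v c 1 u (u ^ 2)"
proof -
  have mor: "proj_morphism K UNIV \<phi>" using iso by (simp add: proj_isomorphism_def)
  have inj: "inj_on \<phi> K" using iso unfolding proj_isomorphism_def inj_on_def by metis
  have "A \<noteq> C" using AC by (auto simp: finite_pt_def infinite_pt_def proj_pt_vector2_eq_iff)
  then obtain a v c where fr: "frame a v c" and A: "A = frame.pt a v c 1 0 0" and C: "C = frame.pt a v c 0 0 1"
    and mem: "\<And>x y z. x \<noteq> 0 \<or> y \<noteq> 0 \<or> z \<noteq> 0 \<Longrightarrow> frame.pt a v c x y z \<in> K \<longleftrightarrow> y ^ 2 = x * z"
    using nonsingular_conic_normal_form[OF K AC(1,2)] by metis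
  interpret frame a v c by (rule fr)
  \<comment> \<open>Exchanging \<open>a\<close> and \<open>c\<close> preserves
    \<open>y^2 = x z\<close> and places \<open>C\<close> at parameter 0 of the second chart.\<close>
  interpret rev: frame c v a using det by unfold_locales (simp add: dot_3 algebra_simps)
  have rev: "rev.pt x y z = pt z y x" for x y z
    by (simp add: pt_def rev.pt_def comb_def rev.comb_def add_ac)
  obtain \<alpha> \<beta> \<gamma> \<delta> where nd: "\<alpha> * \<delta> \<noteq> \<beta> * \<gamma>"
    and \<phi>: "\<And>z. \<phi> (pt 1 z (z ^ 2)) = proj_pt (vector [\<alpha> + \<beta> * z, \<gamma> + \<delta> * z])"
    using morphism_on_conic_chart_moebius[OF mor inj] mem[of 1] by (metis mult_1 zero_neq_one)
  obtain \<alpha>' \<beta>' \<gamma>' \<delta>' where nd': "\<alpha>' * \<delta>' \<noteq> \<beta>' * \<gamma>'"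
    and \<phi>': "\<And>z. \<phi> (pt (z ^ 2) z 1) = proj_pt (vector [\<alpha>' + \<beta>' * z, \<gamma>' + \<delta>' * z])"
    using rev.morphism_on_conic_chart_moebius[OF mor inj] mem[of _ _ 1] unfolding rev
    by (metis mult.right_neutral zero_neq_one)
  have nz: "\<alpha> + \<beta> * z \<noteq> 0 \<or> \<gamma> + \<delta> * z \<noteq> 0" for z using nd by algebra
  have nz': "\<alpha>' + \<beta>' * z \<noteq> 0 \<or> \<gamma>' + \<delta>' * z \<noteq> 0" for z using nd' by algebra
  have "\<alpha> = 0" using \<phi>[of 0] AC A nz[of 0] by (auto simp: finite_pt_def proj_pt_vector2_eq_iff)
  have "\<gamma>' = 0" using \<phi>'[of 0] AC C nz'[of 0] by (auto simp: infinite_pt_def proj_pt_vector2_eq_iff)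
  \<comment> \<open>The two charts overlap by \<open>z \<mapsto> 1 / z\<close>; cross-multiplying
    their representations and clearing \<open>1 / z\<close> gives a polynomial identity.\<close>
  have eq: "\<beta> * \<delta>' * z = (\<alpha>' * z + \<beta>') * (\<gamma> + \<delta> * z)" if "z \<noteq> 0" for z
  proof -
    have "pt 1 z (z ^ 2) = pt ((1 / z) ^ 2) (1 / z) 1"
      using pt_scale[of "z ^ 2" "(1 / z) ^ 2" "1 / z" 1] that by (simp add: field_simps power2_eq_square)
    then have "proj_pt (vector [\<alpha> + \<beta> * z, \<gamma> + \<delta> * z] :: complex ^ 2)
        = proj_pt (vector [\<alpha>' + \<beta>' * (1 / z), \<gamma>' + \<delta>' * (1 / z)])"
      using \<phi>[of z] \<phi>'[of "1 / z"] by simp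
    then have "(\<alpha> + \<beta> * z) * (\<gamma>' + \<delta>' * (1 / z)) = (\<alpha>' + \<beta>' * (1 / z)) * (\<gamma> + \<delta> * z)"
      by (rule iffD1[OF proj_pt_vector2_eq_iff[OF nz nz']])
    moreover have "z * (1 / z) = 1" using that by simp
    ultimately show ?thesis using \<open>\<alpha> = 0\<close> \<open>\<gamma>' = 0\<close> by algebra
  qed
  \<comment> \<open>Three values of \<open>z\<close> suffice to isolate the quadratic coefficient
    \<open>\<alpha>' * \<delta>\<close>, which must vanish. Since \<open>\<gamma>' = 0\<close>
    forces \<open>\<alpha>'\<close> to be nonzero, \<open>\<delta> = 0\<close>.\<close>
  have "\<beta> * \<delta>' = (\<alpha>' + \<beta>') * (\<gamma> + \<delta>)" "- (\<beta> * \<delta>') = (- \<alpha>' + \<beta>') * (\<gamma> - \<delta>)"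
    "\<beta> * \<delta>' * 2 = (\<alpha>' * 2 + \<beta>') * (\<gamma> + \<delta> * 2)"
    using eq[of 1] eq[of "- 1"] eq[of 2] by simp_all
  then have "6 * (\<alpha>' * \<delta>) = 0" by algebra
  then have "\<delta> = 0" using nd' \<open>\<gamma>' = 0\<close> by auto
  have "\<beta> \<noteq> 0" "\<gamma> \<noteq> 0" using nd \<open>\<alpha> = 0\<close> by auto
  \<comment> \<open>The isomorphism now sends the parameter \<open>z\<close> to
    \<open>z / \<kappa>\<close>. Scaling \<open>v\<close> by \<open>\<kappa>\<close> and
    \<open>c\<close> by its square keeps the equation of the conic and makes the parameter equal to
    the image.\<close>
  define \<kappa> where "\<kappa> = \<gamma> / \<beta>"
  have \<kappa>: "\<kappa> \<noteq> 0" using \<open>\<beta> \<noteq> 0\<close> \<open>\<gamma> \<noteq> 0\<close> by (simp add: \<kappa>_def)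
  interpret scaled: frame a "\<kappa> *s v" "\<kappa> ^ 2 *s c"
  proof
    have "dot (\<kappa> *s v) (cross a (\<kappa> ^ 2 *s c)) = \<kappa> ^ 3 * dot v (cross a c)"
      by (simp add: dot_3 power2_eq_square power3_eq_cube algebra_simps)
    then show "dot (\<kappa> *s v) (cross a (\<kappa> ^ 2 *s c)) \<noteq> 0" using det \<kappa> by simp
  qed
  have scaled: "scaled.pt x y z = pt x (\<kappa> * y) (\<kappa> ^ 2 * z)" for x y z
    by (simp add: pt_def scaled.pt_def comb_def scaled.comb_def vector_smult_assoc mult_ac)
  show ?thesis
  proof
    show "frame a (\<kappa> *s v) (\<kappa> ^ 2 *s c)" ..
    show "A = scaled.pt 1 0 0" by (simp add: scaled A)
    show "C = scaled.pt 0 0 1" using pt_scale[of "\<kappa> ^ 2" 0 0 1] \<kappa> by (simp add: scaled C)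
    fix X u assume X: "X \<in> K" "\<phi> X = finite_pt u"
    have "\<phi> (pt 1 (\<kappa> * u) ((\<kappa> * u) ^ 2)) = finite_pt u"
      using \<phi>[of "\<kappa> * u"] nz[of "\<kappa> * u"] \<open>\<beta> \<noteq> 0\<close> \<open>\<gamma> \<noteq> 0\<close>
      by (simp add: \<open>\<alpha> = 0\<close> \<open>\<delta> = 0\<close> finite_pt_def proj_pt_vector2_eq_iff) (simp add: \<kappa>_def)
    moreover have "pt 1 (\<kappa> * u) ((\<kappa> * u) ^ 2) \<in> K" by (simp add: mem)
    ultimately have "X = pt 1 (\<kappa> * u) ((\<kappa> * u) ^ 2)" using X inj by (metis inj_onD)
    then show "X = scaled.pt 1 u (u ^ 2)" by (simp add: scaled power_mult_distrib)
  qed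
qed

section \<open>Chords of the conic and the two Pascal lines\<close>

context frame
begin

definition conic_pt :: "complex \<Rightarrow> 3 proj" where
  "conic_pt u = pt 1 u (u ^ 2)"

text \<open>Substituting \<open>(1, s, s^2)\<close> into the equation of the chord gives
  \<open>(s - u) * (s - w)\<close>. Dividing the coefficients by \<open>u\<close> and letting
  \<open>u\<close> tend to infinity gives those of the next lemma.\<close>

lemma join_conic_pts:
  assumes "u \<noteq> w"
  shows "join (conic_pt u) (conic_pt w) = dual_line (u * w) (- (u + w)) 1"
  unfolding conic_pt_def
proof (rule join_ptI)
  show "u * w ^ 2 - u ^ 2 * w \<noteq> 0 \<or> u ^ 2 * 1 - 1 * w ^ 2 \<noteq> 0 \<or> 1 * w - u * 1 \<noteq> 0"
    using assms by simp
qed (simp_all add: is_line_dual_line pt_in_dual_line_iff power2_eq_square algebra_simps)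

lemma join_pt_at_infinity_conic_pt: "join (pt 0 0 1) (conic_pt w) = dual_line w (- 1) 0"
  unfolding conic_pt_def by (rule join_ptI) (simp_all add: is_line_dual_line pt_in_dual_line_iff)

text \<open>All six intersections have this shape, so each one amounts to a single \<open>y\<close>
  solving two linear equations.\<close>

lemma meet_on_line_1_0_1:
  assumes "p + q * y = r" "p' + q' * y = r'"
    "q * r' - r * q' \<noteq> 0 \<or> r * p' - p * r' \<noteq> 0 \<or> p * q' - q * p' \<noteq> 0"
  shows "meet (dual_line p q r) (dual_line p' q' r') = pt 1 y (- 1)"
  using assms by (intro meet_dual_lineI) (simp_all add: pt_in_dual_line_iff)

text \<open>The points given by \<open>y\<close> and \<open>z\<close> differ, so any line through
  them is their join; this settles the uniqueness in the definite description.\<close>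

lemma pascal_line_eqI:
  assumes "meet (join P1 Q2) (join P2 Q1) = pt 1 x (- 1)"
    "meet (join P2 Q3) (join P3 Q2) = pt 1 y (- 1)"
    "meet (join P1 Q3) (join P3 Q1) = pt 1 z (- 1)" "y \<noteq> z"
  shows "pascal_line P1 P2 P3 Q1 Q2 Q3 = dual_line 1 0 1"
  unfolding pascal_line_def assms(1-3)
proof (rule the_equality)
  show on: "is_line (dual_line 1 0 1) \<and> pt 1 x (- 1) \<in> dual_line 1 0 1 \<and> pt 1 y (- 1) \<in> dual_line 1 0 1 \<and> pt 1 z (- 1) \<in> dual_line 1 0 1"
    by (simp add: is_line_dual_line pt_in_dual_line_iff)
  fix L assume "is_line L \<and> pt 1 x (- 1) \<in> L \<and> pt 1 y (- 1) \<in> L \<and> pt 1 z (- 1) \<in> L"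
  then show "L = dual_line 1 0 1"
    using on \<open>y \<noteq> z\<close> join_ptI[of y "- 1" "- 1" z 1 1] by auto
qed

end

theorem theorem3p4:
  fixes K :: "3 proj set" and A B C D E F :: "3 proj"
  assumes "nonsingular_conic K"
    and "{A, B, C, D, E, F} \<subseteq> K"
    and "distinct [A, B, C, D, E, F]"
    and "ricochet_configuration K A B C D E F"
  shows "pascal_line A B C F E D = pascal_line A E C D B F"
proof -
  obtain \<phi> t where iso: "proj_isomorphism K (UNIV :: 2 proj set) \<phi>"
    and \<phi>: "\<phi> A = finite_pt 0" "\<phi> B = finite_pt t" "\<phi> C = infinite_pt" "\<phi> D = finite_pt 1"
      "\<phi> E = finite_pt ((t - 1) / (t + 1))" "\<phi> F = finite_pt (- 1)"
    using assms(4) unfolding ricochet_configuration_def by blast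
  obtain a v c where fr: "frame a v c" and A: "A = frame.pt a v c 1 0 0" and C: "C = frame.pt a v c 0 0 1"
    and param: "\<And>X u. X \<in> K \<Longrightarrow> \<phi> X = finite_pt u \<Longrightarrow> X = frame.pt a v c 1 u (u ^ 2)"
    using conic_isomorphism_coordinates[OF assms(1) iso _ _ \<phi>(1,3)] assms(2) by auto
  interpret frame a v c by (rule fr)
  define e where "e = (t - 1) / (t + 1)"
  have eqs: "A = conic_pt 0" "B = conic_pt t" "D = conic_pt 1" "E = conic_pt e" "F = conic_pt (- 1)"
    using param[OF _ \<phi>(1)] param[OF _ \<phi>(2)] param[OF _ \<phi>(4)] param[OF _ \<phi>(5)] param[OF _ \<phi>(6)] assms(2)
    by (simp_all add: e_def conic_pt_def)
  \<comment> \<open>Here \<open>B\<close> is distinct from \<open>A\<close>, \<open>D\<close> and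
    \<open>F\<close>, which have parameters 0, 1 and -1.\<close>
  have t: "t \<noteq> 0" "t \<noteq> 1" "t \<noteq> - 1" using assms(3) eqs by auto
  then have t1: "t + 1 \<noteq> 0" by (simp add: add_eq_0_iff2)
  \<comment> \<open>The ricochet relation between the parameters of \<open>B\<close> and
    \<open>E\<close>, cleared of its denominator. It is what makes the intersections below fall on
    \<open>x + z = 0\<close>.\<close>
  then have et: "e * (t + 1) = t - 1" by (simp add: e_def)
  have e: "e \<noteq> 0" "e \<noteq> 1" "e \<noteq> - 1" using et t by auto
  have joins: "join A E = dual_line 0 (- e) 1" "join B F = dual_line (- t) (1 - t) 1" "join B D = dual_line t (- t - 1) 1"
    "join C E = dual_line e (- 1) 0" "join A D = dual_line 0 (- 1) 1" "join C F = dual_line (- 1) (- 1) 0"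
    "join A B = dual_line 0 (- t) 1" "join E D = dual_line e (- e - 1) 1" "join E F = dual_line (- e) (1 - e) 1"
    "join C B = dual_line t (- 1) 0" "join A F = dual_line 0 1 1" "join C D = dual_line 1 (- 1) 0"
    unfolding eqs C join_pt_at_infinity_conic_pt using t e by (simp_all add: join_conic_pts)
  have "pascal_line A B C F E D = dual_line 1 0 1"
  proof (rule pascal_line_eqI)
    \<comment> \<open>The value of \<open>y\<close> is read off from \<open>join A E\<close>, whose
      equation has no \<open>x\<close> term; that \<open>join B F\<close> passes through the same
      point is the relation \<open>et\<close>.\<close>
    have "- e * (- 1 / e) = 1" using e by simp
    then show "meet (join A E) (join B F) = pt 1 (- 1 / e) (- 1)"
      unfolding joins using t et by (intro meet_on_line_1_0_1) (simp, algebra, simp)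
    show "meet (join B D) (join C E) = pt 1 e (- 1)"
      unfolding joins using et by (intro meet_on_line_1_0_1) (algebra, simp_all)
    show "meet (join A D) (join C F) = pt 1 (- 1) (- 1)"
      unfolding joins by (intro meet_on_line_1_0_1) simp_all
  qed (rule e)
  moreover have "pascal_line A E C D B F = dual_line 1 0 1"
  proof (rule pascal_line_eqI)
    \<comment> \<open>Again the chord through \<open>A\<close> determines \<open>y\<close>, and
      \<open>et\<close> places the point on \<open>join E D\<close>.\<close>
    have "- t * (- 1 / t) = 1" using t by simp
    then show "meet (join A B) (join E D) = pt 1 (- 1 / t) (- 1)"
      unfolding joins using e t et by (intro meet_on_line_1_0_1) (simp, algebra, simp)
    show "meet (join E F) (join C B) = pt 1 t (- 1)"
      unfolding joins using et by (intro meet_on_line_1_0_1) (algebra, simp_all)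
    show "meet (join A F) (join C D) = pt 1 1 (- 1)"
      unfolding joins by (intro meet_on_line_1_0_1) simp_all
  qed (rule t)
  ultimately show ?thesis by simp
qed

end
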